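(* For all integers $n\geq 0$, $p^{\mathrm{eu}}_{\mathrm{od}}(n)\leq p^{\mathrm{ou}}_{\mathrm{ed}}(n)$. Moreover, $p^{\mathrm{eu}}_{\mathrm{od}}(n)< p^{\mathrm{ou}}_{\mathrm{ed}}(n)$ for all $n\geq 5$.
   Context: A partition of a non-negative integer $n$ is a non-increasing (finite, possibly empty) sequence of positive integers, called parts, summing to $n$. $p^{\mathrm{eu}}_{\mathrm{od}}(n)$ is the number of partitions of $n$ in which every even part is larger than every odd part, the odd parts are pairwise distinct, and the even parts are unrestricted (may be repeated). $p^{\mathrm{ou}}_{\mathrm{ed}}(n)$ is the number of partitions of $n$ in which every odd part is larger than every even part, the even parts are pairwise distinct, and the odd parts are unrestricted (may be repeated). In both cases partitions with no even parts or with no odd parts are allowed. *)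

theory Defs
  imports Main
begin

definition partitions :: "nat \<Rightarrow> nat list set" where
  "partitions n = {xs. sorted_wrt (\<ge>) xs \<and> (\<forall>x \<in> set xs. 0 < x) \<and> sum_list xs = n}"

text \<open>
  In the names below, e/o stand for the even/odd parts and u/d for unrestricted/distinct;
  the parity class in the subscript position (named last) consists of the smaller parts.
\<close>

definition eu_od_partitions :: "nat \<Rightarrow> nat list set" where
  "eu_od_partitions n = {xs \<in> partitions n.
     (\<forall>x \<in> set xs. \<forall>y \<in> set xs. even x \<longrightarrow> odd y \<longrightarrow> y < x) \<and>
     distinct (filter odd xs)}"

definition ou_ed_partitions :: "nat \<Rightarrow> nat list set" where
  "ou_ed_partitions n = {xs \<in> partitions n.
     (\<forall>x \<in> set xs. \<forall>y \<in> set xs. odd x \<longrightarrow> even y \<longrightarrow> y < x) \<and>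
     distinct (filter even xs)}"

definition p_eu_od :: "nat \<Rightarrow> nat" where
  "p_eu_od n = card (eu_od_partitions n)"

definition p_ou_ed :: "nat \<Rightarrow> nat" where
  "p_ou_ed n = card (ou_ed_partitions n)"

text \<open>Finiteness, so that the cardinalities above are genuine counts.\<close>

lemma finite_partitions: "finite (partitions n)"
proof -
  have len: "length xs \<le> sum_list xs" if "\<forall>x \<in> set xs. 0 < x" for xs :: "nat list"
    using that by (induction xs) auto
  have "partitions n \<subseteq> {xs. set xs \<subseteq> {..n} \<and> length xs \<le> n}"
    using len member_le_sum_list by (fastforce simp: partitions_def)
  then show ?thesis
    using finite_lists_length_le[of "{..n}" n] finite_subset by blast
qed

lemma finite_eu_od_partitions: "finite (eu_od_partitions n)"
  using finite_partitions by (simp add: eu_od_partitions_def)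

lemma finite_ou_ed_partitions: "finite (ou_ed_partitions n)"
  using finite_partitions by (simp add: ou_ed_partitions_def)

end

theory Submission
  imports Defs
begin

text \<open>
  Write \<open>(q\<^sup>2)\<^sub>r = (1 - q\<^sup>2) \<cdots> (1 - q\<^sup>2\<^sup>r)\<close>. Sort partitions by their number \<open>r\<close> of parts and the number \<open>k\<close>
  of distinct small parts, and subtract the least such partition; what is left is twice a weakly
  decreasing list of length \<open>r\<close>. Hence the generating functions are
  \<open>\<Sum>\<^sub>r (q\<^sup>2\<^sup>r + \<Sum>\<^sub>1\<^sub>\<le>\<^sub>k\<^sub>\<le>\<^sub>r q\<^sup>k\<^sup>(\<^sup>2\<^sup>r\<^sup>-\<^sup>k\<^sup>)) / (q\<^sup>2)\<^sub>r\<close> for \<open>p_eu_od\<close> and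
  \<open>\<Sum>\<^sub>r \<Sum>\<^sub>0\<^sub>\<le>\<^sub>k\<^sub>\<le>\<^sub>r q\<^sup>k\<^sup>(\<^sup>2\<^sup>r\<^sup>-\<^sup>k\<^sup>)\<^sup>+\<^sup>r / (q\<^sup>2)\<^sub>r\<close> for \<open>p_ou_ed\<close>.
  The summands with \<open>k = 0\<close> of the second almost suffice to dominate the first: splitting by the largest part,
  \<open>q\<^sup>r / (q\<^sup>2)\<^sub>r = q\<^sup>r / (q\<^sup>2)\<^sub>s + \<Sum>\<^sub>s\<^sub><\<^sub>L\<^sub>\<le>\<^sub>r q\<^sup>r\<^sup>+\<^sup>2\<^sup>L / (q\<^sup>2)\<^sub>L\<close>
  with \<open>s = \<lceil>r/2\<rceil>\<close>. The first terms are the summands \<open>k \<le> 1\<close> of \<open>p_eu_od\<close>. For fixed \<open>L\<close>, the others run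
  over \<open>L \<le> r \<le> 2L - 2\<close> and, if \<open>L \<ge> 4\<close>, dominate the \<open>L - 1\<close> summands \<open>2 \<le> k \<le> L\<close> one by one, because the
  coefficients of \<open>q\<^sup>e / (q\<^sup>2)\<^sub>L\<close> do not increase when \<open>e\<close> grows by 2. The cases \<open>L = 2, 3\<close> are repaired
  with the summands \<open>(r, k) = (1, 1), (3, 1)\<close> of \<open>p_ou_ed\<close>; the summands \<open>(2, 1)\<close> and \<open>(2, 2)\<close> remain and
  give strictness.
\<close>

section \<open>Weakly decreasing lists of fixed length\<close>

definition weak_partitions :: "nat \<Rightarrow> nat \<Rightarrow> nat list set" where
  "weak_partitions r N = {ys. length ys = r \<and> sorted_wrt (\<ge>) ys \<and> sum_list ys = N}"

lemma finite_weak_partitions: "finite (weak_partitions r N)"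
proof -
  have "weak_partitions r N \<subseteq> {ys. set ys \<subseteq> {..N} \<and> length ys = r}"
    using member_le_sum_list by (fastforce simp: weak_partitions_def)
  then show ?thesis
    using finite_lists_length_eq[of "{..N}" r] finite_subset by blast
qed

lemma sum_list_map_add: "sum_list (map (\<lambda>x. x + c) xs) = sum_list xs + c * length xs" for c :: nat
  by (induction xs) auto

lemma weak_partitions_Suc:
  "weak_partitions (Suc r) N = (\<lambda>ys. ys @ [0]) ` weak_partitions r N \<union>
     (if Suc r \<le> N then map Suc ` weak_partitions (Suc r) (N - Suc r) else {})"
    (is "?L = ?A \<union> ?B")
proof
  show "?L \<subseteq> ?A \<union> ?B"
  proof
    fix ys assume ys: "ys \<in> ?L"
    then obtain zs z where z: "ys = zs @ [z]"
      by (cases ys rule: rev_cases) (auto simp: weak_partitions_def)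
    show "ys \<in> ?A \<union> ?B"
    proof (cases "z = 0")
      case True
      then have "zs \<in> weak_partitions r N"
        using ys z by (auto simp: weak_partitions_def sorted_wrt_append)
      then show ?thesis using z True by auto
    next
      case False
      define ws where "ws = map (\<lambda>y. y - 1) ys"
      have pos: "\<forall>y\<in>set ys. 0 < y"
        using ys z False by (auto simp: weak_partitions_def sorted_wrt_append)
      have eq: "ys = map Suc ws"
        unfolding ws_def using pos by (simp add: map_idI)
      have len: "length ws = Suc r" using ys by (simp add: ws_def weak_partitions_def)
      have "sum_list ys = sum_list ws + Suc r"
        using sum_list_map_add[of 1 ws] len eq by (simp add: comp_def)
      then have "Suc r \<le> N \<and> ws \<in> weak_partitions (Suc r) (N - Suc r)"
        using ys len unfolding eq by (auto simp: weak_partitions_def sorted_wrt_map)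
      then show ?thesis using eq by auto
    qed
  qed
  show "?A \<union> ?B \<subseteq> ?L"
    using sum_list_map_add[of 1]
    by (auto simp: weak_partitions_def sorted_wrt_append sorted_wrt_map comp_def split: if_splits)
qed

text \<open>The coefficient of \<open>q\<^sup>n\<close> in \<open>q\<^sup>e / ((1 - q\<^sup>2) (1 - q\<^sup>4) \<cdots> (1 - q\<^sup>2\<^sup>r))\<close>.\<close>

definition coef :: "nat \<Rightarrow> nat \<Rightarrow> nat \<Rightarrow> nat" where
  "coef r e n = (if e \<le> n \<and> even (n - e) then card (weak_partitions r ((n - e) div 2)) else 0)"

lemma card_weak_partitions_Suc:
  "card (weak_partitions (Suc r) N) = card (weak_partitions r N) +
     (if Suc r \<le> N then card (weak_partitions (Suc r) (N - Suc r)) else 0)"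
proof -
  have "card (weak_partitions (Suc r) N) = card ((\<lambda>ys. ys @ [0]) ` weak_partitions r N) +
     card (if Suc r \<le> N then map Suc ` weak_partitions (Suc r) (N - Suc r) else {})"
    unfolding weak_partitions_Suc[of r N]
  proof (rule card_Un_disjoint)
    have "ys @ [0] \<noteq> map Suc zs" for ys zs
      by (metis in_set_conv_decomp list.set_map imageE nat.distinct(1))
    then show "(\<lambda>ys. ys @ [0]) ` weak_partitions r N \<inter>
      (if Suc r \<le> N then map Suc ` weak_partitions (Suc r) (N - Suc r) else {}) = {}"
      by auto
  qed (auto simp: finite_weak_partitions)
  moreover have "card ((\<lambda>ys. ys @ [0]) ` weak_partitions r N) = card (weak_partitions r N)"
    by (rule card_image) (auto simp: inj_on_def)
  moreover have "card (map Suc ` weak_partitions (Suc r) M) = card (weak_partitions (Suc r) M)" for M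
    by (rule card_image) (auto simp: inj_on_def inj_map_eq_map)
  ultimately show ?thesis by auto
qed

text \<open>With m = r + 1 this is 1 / (1 - q^(2m)) = 1 + q^(2m) / (1 - q^(2m)), multiplied by the
  remaining factors.\<close>

lemma coef_Suc: "coef (Suc r) e n = coef r e n + coef (Suc r) (e + 2 * Suc r) n"
proof (cases "e \<le> n \<and> even (n - e)")
  case True
  then obtain m where "n = e + 2 * m" by (metis dvdE le_add_diff_inverse)
  then show ?thesis
    using card_weak_partitions_Suc[of r m]
    by (auto simp: coef_def diff_mult_distrib2[symmetric] simp del: mult_Suc_right)
next
  case False
  then show ?thesis by (auto simp: coef_def)
qed

text \<open>Increasing the largest entry by 1 is injective; this requires a nonempty list, hence
  \<open>Suc r\<close>.\<close>

lemma coef_add_two_le: "coef (Suc r) (e + 2) n \<le> coef (Suc r) e n"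
proof (cases "e + 2 \<le> n \<and> even (n - (e + 2))")
  case True
  then obtain m where m: "n = e + 2 + 2 * m" by (metis dvdE le_add_diff_inverse)
  define f where "f = (\<lambda>ys::nat list. Suc (hd ys) # tl ys)"
  have "card (weak_partitions (Suc r) m) \<le> card (weak_partitions (Suc r) (Suc m))"
  proof (rule card_inj_on_le[of f])
    have "ys \<noteq> []" if "ys \<in> weak_partitions (Suc r) m" for ys
      using that by (auto simp: weak_partitions_def)
    then show "inj_on f (weak_partitions (Suc r) m)"
      by (auto simp: inj_on_def f_def intro: list.expand)
    have "f ys \<in> weak_partitions (Suc r) (Suc m)" if "ys \<in> weak_partitions (Suc r) m" for ys
      using that by (cases ys) (auto simp: f_def weak_partitions_def le_SucI)
    then show "f ` weak_partitions (Suc r) m \<subseteq> weak_partitions (Suc r) (Suc m)"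
      by blast
  qed (rule finite_weak_partitions)
  then show ?thesis using m by (simp add: coef_def)
next
  case False
  then show ?thesis by (auto simp: coef_def)
qed

lemma coef_antimono:
  assumes "0 < r" "e \<le> e'" "even (e' - e)"
  shows "coef r e' n \<le> coef r e n"
proof -
  obtain s where s: "r = Suc s" using assms by (cases r) auto
  obtain d where d: "e' = e + 2 * d" using assms by (metis dvdE le_add_diff_inverse)
  have "coef r (e + 2 * d) n \<le> coef r e n"
  proof (induction d)
    case (Suc d)
    then show ?case using coef_add_two_le[of s "e + 2 * d" n] s by (simp add: add.commute)
  qed simp
  then show ?thesis using d by simp
qed

lemma coef_pos:
  assumes "0 < r" "e \<le> n" "even (n - e)"
  shows "0 < coef r e n"
proof -
  \<comment> \<open>At exponent n the remainder is 0, which the list of zeros realises.\<close>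
  have "coef r n n \<le> coef r e n" using assms by (intro coef_antimono) auto
  moreover have "replicate r 0 \<in> weak_partitions r 0"
    by (simp add: weak_partitions_def sorted_wrt_iff_nth_less sum_list_replicate)
  then have "0 < card (weak_partitions r 0)"
    using finite_weak_partitions card_gt_0_iff by blast
  ultimately show ?thesis by (simp add: coef_def)
qed

text \<open>Iterates \<open>coef_Suc\<close>: the summand for L counts the lists with exactly L
  nonzero entries, and \<open>coef s e n\<close> those with at most s.\<close>

lemma coef_expand:
  assumes "s \<le> r"
  shows "coef r e n = coef s e n + (\<Sum>L\<in>{s<..r}. coef L (e + 2 * L) n)"
  using assms
proof (induction rule: dec_induct)
  case (step r)
  have "{s<..Suc r} = insert (Suc r) {s<..r}" using step by auto
  then show ?case using step coef_Suc[of r e n] by simp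
qed simp

section \<open>Separated lists\<close>

text \<open>Sequences sorted by \<open>sep_rel\<close> are the partitions counted by \<open>p_eu_od\<close> with zeros allowed;
  adding 1 to every entry turns them into those counted by \<open>p_ou_ed\<close>.\<close>

definition sep_rel :: "nat \<Rightarrow> nat \<Rightarrow> bool" where
  "sep_rel x y \<longleftrightarrow> y \<le> x \<and> (odd x \<longrightarrow> odd y \<and> y < x)"

definition sep_lists :: "nat \<Rightarrow> nat \<Rightarrow> nat \<Rightarrow> nat list set" where
  "sep_lists r k N = {xs. sorted_wrt sep_rel xs \<and> length xs = r \<and>
     length (filter odd xs) = k \<and> sum_list xs = N}"

text \<open>Adds twice the given list to \<open>2k, \<dots>, 2k, 2k - 1, 2k - 3, \<dots>, 3, 1\<close>, which is the
  least separated list of its length with \<open>k\<close> odd entries.\<close>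

fun stack :: "nat \<Rightarrow> nat list \<Rightarrow> nat list" where
  "stack k [] = []"
| "stack k (y # ys) = (if length ys < k then (2 * y + 2 * k - 1) # stack (k - 1) ys
     else (2 * y + 2 * k) # stack k ys)"

lemma length_stack [simp]: "length (stack k ys) = length ys"
  by (induction k ys rule: stack.induct) auto

lemma stack_inj: "length ys = length zs \<Longrightarrow> stack k ys = stack k zs \<Longrightarrow> ys = zs"
proof (induction ys zs arbitrary: k rule: list_induct2)
  case (Cons y ys z zs)
  then show ?case by (auto split: if_splits)
qed simp

text \<open>With r the length, the least list has r - k entries 2k and the odd numbers 1, ..., 2k -
  1, in total 2k(r - k) + k^2 = k(2r - k).\<close>

lemma sum_list_stack:
  "k \<le> length ys \<Longrightarrow> sum_list (stack k ys) = 2 * sum_list ys + k * (2 * length ys - k)"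
proof (induction ys arbitrary: k)
  case (Cons y ys)
  show ?case
  proof (cases "length ys < k")
    case True
    then have k: "k = Suc (length ys)" using Cons.prems by simp
    show ?thesis using Cons.IH[of "length ys"] by (simp add: k algebra_simps)
  next
    case False
    then obtain d where "length ys = k + d" using le_Suc_ex not_less by blast
    then show ?thesis using Cons.IH[of k] by (simp add: algebra_simps)
  qed
qed simp

lemma length_filter_odd_stack: "k \<le> length ys \<Longrightarrow> length (filter odd (stack k ys)) = k"
proof (induction ys arbitrary: k)
  case (Cons y ys)
  then show ?case by (cases "length ys < k") auto
qed simp

lemma stack_le: "x \<in> set (stack k ys) \<Longrightarrow> \<forall>y\<in>set ys. y \<le> b \<Longrightarrow> x \<le> 2 * b + 2 * k"
proof (induction ys arbitrary: k)
  case (Cons y ys)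
  then show ?case by (fastforce split: if_splits)
qed simp

lemma sorted_stack:
  "k \<le> length ys \<Longrightarrow> sorted_wrt (\<ge>) ys \<Longrightarrow> sorted_wrt sep_rel (stack k ys)"
proof (induction ys arbitrary: k)
  case (Cons y ys)
  show ?case
  proof (cases "length ys < k")
    case True
    then have k: "k = Suc (length ys)" using Cons.prems by simp
    have "odd x" if "x \<in> set (stack (length ys) ys)" for x
      using that length_filter_odd_stack[of "length ys" ys]
      by (metis filter_id_conv length_filter_less less_irrefl length_stack order_refl)
    moreover have "x \<le> 2 * y + 2 * length ys" if "x \<in> set (stack (length ys) ys)" for x
      using that stack_le[of x "length ys" ys y] Cons.prems by simp
    ultimately have "\<forall>x\<in>set (stack (length ys) ys). sep_rel (2 * y + 2 * k - 1) x"
      by (auto simp: k sep_rel_def less_Suc_eq_le le_SucI)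
    then show ?thesis
      using Cons.IH[of "length ys"] Cons.prems(2) by (simp add: k)
  next
    case False
    then show ?thesis
      using Cons.IH[of k] Cons.prems stack_le[of _ k ys y] by (auto simp: sep_rel_def)
  qed
qed simp

lemma stack_surj:
  "sorted_wrt sep_rel xs \<Longrightarrow>
   \<exists>ys. sorted_wrt (\<ge>) ys \<and> length ys = length xs \<and> stack (length (filter odd xs)) ys = xs"
proof (induction xs)
  case (Cons x xs)
  then obtain ys where ys: "sorted_wrt (\<ge>) ys" "length ys = length xs"
    "stack (length (filter odd xs)) ys = xs" by auto
  define k where "k = length (filter odd (x # xs))"
  \<comment> \<open>Inverts both branches of \<open>stack\<close> at once: x is 2y + 2k - 1 or 2y +
    2k, according to its parity.\<close>
  define y where "y = (x + 1) div 2 - k"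
  have "stack k (y # ys) = x # xs \<and> (\<forall>z\<in>set ys. z \<le> y)"
  proof (cases "odd x")
    case True
    \<comment> \<open>Only odd entries may follow an odd one.\<close>
    then have "filter odd xs = xs" using Cons.prems by (auto simp: sep_rel_def filter_id_conv)
    then have k: "k = Suc (length xs)" and st: "stack (length xs) ys = xs"
      using True ys by (simp_all add: k_def)
    have *: "2 * k \<le> x + 1 \<and> (\<forall>z\<in>set ys. z \<le> y)"
    proof (cases ys)
      case Nil
      then show ?thesis using k ys(2) True by (auto elim: oddE)
    next
      case (Cons z zs)
      have "2 * z + 2 * length xs - 1 \<in> set (stack (length xs) ys)"
        using ys(2) Cons by simp
      then have "2 * z + 2 * length xs - 1 < x"
        using st Cons.prems True by (auto simp: sep_rel_def)
      moreover have "0 < length xs" using ys(2) Cons by (cases xs) auto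
      \<comment> \<open>Both sides of the strict inequality are odd, so they differ by at least
        2.\<close>
      ultimately have "2 * k + 2 * z \<le> x + 1" using True k by presburger
      then have "z \<le> y" "2 * k \<le> x + 1" by (auto simp: y_def)
      then show ?thesis using ys(1) Cons by auto
    qed
    then have "2 * y + 2 * k - 1 = x" using True by (auto simp: y_def elim!: oddE)
    then show ?thesis using * ys st k by simp
  next
    case False
    then have k: "k = length (filter odd xs)" by (simp add: k_def)
    then have kl: "k \<le> length ys" using ys(2) by simp
    have *: "2 * k \<le> x \<and> (\<forall>z\<in>set ys. z \<le> y)"
    proof (cases ys)
      case Nil
      then show ?thesis using kl by simp
    next
      case (Cons z zs)
      have "2 * z + 2 * k - 1 \<in> set (stack k ys) \<or> 2 * z + 2 * k \<in> set (stack k ys)"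
        using Cons by simp
      then have "2 * z + 2 * k - 1 \<le> x"
        using ys(3) k Cons.prems by (auto simp: sep_rel_def)
      then have "2 * k + 2 * z \<le> x" using False by presburger
      then have "z \<le> y" "2 * k \<le> x" by (auto simp: y_def)
      then show ?thesis using ys(1) Cons by auto
    qed
    then have "2 * y + 2 * k = x" using False by (auto simp: y_def elim!: evenE)
    then show ?thesis using * ys(3) kl k[symmetric] by simp
  qed
  then show ?case using ys unfolding k_def
    by (intro exI[of _ "y # ys"]) simp
qed simp

lemma finite_sep_lists: "finite (sep_lists r k N)"
proof -
  have "sep_lists r k N \<subseteq> {ys. set ys \<subseteq> {..N} \<and> length ys = r}"
    using member_le_sum_list by (fastforce simp: sep_lists_def)
  then show ?thesis
    using finite_lists_length_eq[of "{..N}" r] finite_subset by blast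
qed

lemma card_sep_lists:
  assumes "k \<le> r"
  shows "card (sep_lists r k N) = coef r (k * (2 * r - k)) N"
proof (cases "k * (2 * r - k) \<le> N \<and> even (N - k * (2 * r - k))")
  case True
  then obtain m where m: "N = k * (2 * r - k) + 2 * m" by (metis dvdE le_add_diff_inverse)
  have "stack k ` weak_partitions r m = sep_lists r k N"
  proof
    show "stack k ` weak_partitions r m \<subseteq> sep_lists r k N"
      using assms m sorted_stack length_filter_odd_stack sum_list_stack
      by (auto simp: weak_partitions_def sep_lists_def)
    show "sep_lists r k N \<subseteq> stack k ` weak_partitions r m"
    proof
      fix xs assume xs: "xs \<in> sep_lists r k N"
      then obtain ys where ys: "sorted_wrt (\<ge>) ys" "length ys = r" "stack k ys = xs"
        using stack_surj[of xs] by (auto simp: sep_lists_def)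
      then have "sum_list ys = m"
        using sum_list_stack[of k ys] assms xs m by (simp add: sep_lists_def)
      then show "xs \<in> stack k ` weak_partitions r m"
        using ys by (auto simp: weak_partitions_def)
    qed
  qed
  moreover have "inj_on (stack k) (weak_partitions r m)"
    using stack_inj by (auto simp: inj_on_def weak_partitions_def)
  ultimately have "card (sep_lists r k N) = card (weak_partitions r m)"
    using card_image by metis
  then show ?thesis using m by (simp add: coef_def)
next
  case False
  have "sep_lists r k N = {}"
  proof (rule ccontr)
    assume "sep_lists r k N \<noteq> {}"
    then obtain xs where xs: "xs \<in> sep_lists r k N" by auto
    then obtain ys where ys: "sorted_wrt (\<ge>) ys" "length ys = r" "stack k ys = xs"
      using stack_surj[of xs] by (auto simp: sep_lists_def)
    then have "N = 2 * sum_list ys + k * (2 * r - k)"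
      using sum_list_stack[of k ys] assms xs by (simp add: sep_lists_def)
    then show False using False by simp
  qed
  then show ?thesis using False by (auto simp: coef_def)
qed

section \<open>From partition counts to coefficient sums\<close>

lemma distinct_filter_sep:
  fixes xs :: "nat list"
  assumes "sorted_wrt (\<lambda>x y. y \<le> x \<and> (P x \<longrightarrow> P y \<and> y < x)) xs"
  shows "distinct (filter P xs)"
  using assms by (induction xs) auto

lemma eu_od_sorted:
  assumes "xs \<in> eu_od_partitions n"
  shows "sorted_wrt sep_rel xs"
proof -
  have "sorted_wrt (\<ge>) xs" "distinct (filter odd xs)"
    "\<forall>x \<in> set xs. \<forall>y \<in> set xs. even x \<longrightarrow> odd y \<longrightarrow> y < x"
    using assms by (auto simp: eu_od_partitions_def partitions_def)
  then show ?thesis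
  proof (induction xs)
    case (Cons x xs)
    have "sep_rel x y" if "y \<in> set xs" for y
    proof -
      have "y \<le> x" "odd x \<Longrightarrow> odd y \<Longrightarrow> y \<noteq> x" "odd x \<Longrightarrow> even y \<Longrightarrow> x < y"
        using Cons.prems that by auto
      then show ?thesis by (force simp: sep_rel_def)
    qed
    then show ?case using Cons by (auto split: if_splits)
  qed simp
qed

lemma map_Suc_ou_ed:
  assumes "sorted_wrt sep_rel xs"
  shows "map Suc xs \<in> ou_ed_partitions (sum_list xs + length xs)"
proof -
  let ?R = "\<lambda>x y. y \<le> x \<and> (even x \<longrightarrow> even y \<and> y < x)"
  have R: "sorted_wrt ?R (map Suc xs)"
    using assms by (simp add: sorted_wrt_map sep_rel_def[abs_def])
  have "y < x" if "sorted_wrt ?R ys" "x \<in> set ys" "y \<in> set ys" "odd x" "even y" for ys :: "nat list" and x y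
    using that by (induction ys) (auto simp: nat_less_le)
  then show ?thesis
    using R distinct_filter_sep[OF R] sorted_wrt_mono_rel[OF _ R, of "(\<ge>)"] sum_list_map_add[of 1 xs]
    by (auto simp: ou_ed_partitions_def partitions_def comp_def)
qed

text \<open>Zero entries must be excluded. If k = 0, all parts are at least 2, and subtracting 2
  from each accounts for the exponent 2r. If k \<ge> 1, the last entry is odd, hence positive
  already.\<close>

lemma p_eu_od_le:
  "p_eu_od n \<le> (\<Sum>r\<le>n. coef r (2 * r) n + (\<Sum>k\<in>{1..r}. coef r (k * (2 * r - k)) n))"
proof -
  define Z where "Z = (\<lambda>r. if 2 * r \<le> n then map (\<lambda>x. x + 2) ` sep_lists r 0 (n - 2 * r) else {})"
  define S where "S = (\<lambda>r. Z r \<union> (\<Union>k\<in>{1..r}. sep_lists r k n))"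
  have fin: "finite (Z r)" "finite (S r)" for r
    by (auto simp: Z_def S_def finite_sep_lists)
  have "eu_od_partitions n \<subseteq> (\<Union>r\<le>n. S r)"
  proof
    fix xs assume xs: "xs \<in> eu_od_partitions n"
    define r where "r = length xs"
    define k where "k = length (filter odd xs)"
    have sep: "sorted_wrt sep_rel xs" by (rule eu_od_sorted[OF xs])
    have pos: "\<forall>x\<in>set xs. 0 < x" and sum: "sum_list xs = n"
      using xs by (auto simp: eu_od_partitions_def partitions_def)
    have "length xs \<le> sum_list xs" if "\<forall>x\<in>set xs. 0 < x" for xs :: "nat list"
      using that by (induction xs) auto
    then have rn: "r \<le> n" using pos sum r_def by auto
    have "xs \<in> S r"
    proof (cases "k = 0")
      case True
      then have ev: "\<forall>x\<in>set xs. even x" by (simp add: k_def filter_empty_conv)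
      define ys where "ys = map (\<lambda>x. x - 2) xs"
      have "x - 2 + 2 = x" if "x \<in> set xs" for x
        using ev pos that by (cases "x = 1") fastforce+
      then have eq: "xs = map (\<lambda>x. x + 2) ys"
        by (simp add: ys_def comp_def map_idI)
      have len: "length ys = r" by (simp add: ys_def r_def)
      have "n = sum_list ys + 2 * r"
        using sum[unfolded eq] sum_list_map_add[of 2 ys] len by simp
      moreover have "sorted_wrt sep_rel ys"
        using sep unfolding eq by (simp add: sorted_wrt_map sep_rel_def[abs_def])
      moreover have "filter odd ys = []" using ev unfolding eq by (simp add: filter_empty_conv)
      ultimately have "2 * r \<le> n" "ys \<in> sep_lists r 0 (n - 2 * r)"
        using len by (auto simp: sep_lists_def)
      then show ?thesis using eq by (simp add: S_def Z_def)
    next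
      case False
      then have "k \<in> {1..r}" using length_filter_le[of odd xs] by (simp add: k_def r_def flip: k_def)
      moreover have "xs \<in> sep_lists r k n"
        using sep sum by (simp add: sep_lists_def k_def r_def)
      ultimately show ?thesis by (auto simp: S_def)
    qed
    then show "xs \<in> (\<Union>r\<le>n. S r)" using rn by auto
  qed
  then have "p_eu_od n \<le> card (\<Union>r\<le>n. S r)"
    unfolding p_eu_od_def using fin by (intro card_mono) auto
  also have "\<dots> \<le> (\<Sum>r\<le>n. card (S r))" by (rule card_UN_le) simp
  also have "\<dots> \<le> (\<Sum>r\<le>n. coef r (2 * r) n + (\<Sum>k\<in>{1..r}. coef r (k * (2 * r - k)) n))"
  proof (rule sum_mono)
    fix r
    have "card (Z r) \<le> coef r (2 * r) n"
    proof (cases "2 * r \<le> n")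
      case True
      then have "card (Z r) \<le> card (sep_lists r 0 (n - 2 * r))"
        by (simp add: Z_def card_image_le finite_sep_lists)
      also have "\<dots> = coef r (2 * r) n" using True by (simp add: card_sep_lists coef_def)
      finally show ?thesis .
    qed (simp add: Z_def)
    moreover have "card (\<Union>k\<in>{1..r}. sep_lists r k n) \<le> (\<Sum>k\<in>{1..r}. coef r (k * (2 * r - k)) n)"
      using card_UN_le[of "{1..r}" "\<lambda>k. sep_lists r k n"] by (simp add: card_sep_lists)
    ultimately show "card (S r) \<le> coef r (2 * r) n + (\<Sum>k\<in>{1..r}. coef r (k * (2 * r - k)) n)"
      unfolding S_def using card_Un_le[of "Z r" "\<Union>k\<in>{1..r}. sep_lists r k n"] by linarith
  qed
  finally show ?thesis .
qed

lemma p_ou_ed_ge: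
  assumes "finite I" "\<And>r k. (r, k) \<in> I \<Longrightarrow> k \<le> r"
  shows "(\<Sum>(r, k)\<in>I. coef r (k * (2 * r - k) + r) n) \<le> p_ou_ed n"
proof -
  define T where "T = (\<lambda>(r, k). if r \<le> n then map Suc ` sep_lists r k (n - r) else {})"
  have card: "card (T (r, k)) = coef r (k * (2 * r - k) + r) n" if "(r, k) \<in> I" for r k
  proof (cases "r \<le> n")
    case True
    have "card (T (r, k)) = card (sep_lists r k (n - r))"
      unfolding T_def using True by (auto intro!: card_image simp: inj_on_def inj_map_eq_map)
    then show ?thesis
      using card_sep_lists[OF assms(2)[OF that]] True
      by (auto simp: coef_def add.commute le_diff_conv2)
  qed (simp add: T_def coef_def)
  \<comment> \<open>The length and the number of even parts of a list in \<open>T (r, k)\<close>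
    recover r and k.\<close>
  have disj: "T i \<inter> T j = {}" if "i \<noteq> j" for i j
    using that by (cases i; cases j) (auto simp: T_def sep_lists_def inj_map_eq_map)
  have fin: "finite (T i)" for i by (cases i) (auto simp: T_def finite_sep_lists)
  have "(\<Sum>(r, k)\<in>I. coef r (k * (2 * r - k) + r) n) = (\<Sum>i\<in>I. card (T i))"
    using card by (intro sum.cong) auto
  also have "\<dots> = card (\<Union>i\<in>I. T i)"
    using assms(1) fin disj by (subst card_UN_disjoint) auto
  also have "\<dots> \<le> p_ou_ed n"
    unfolding p_ou_ed_def
  proof (rule card_mono[OF finite_ou_ed_partitions])
    show "(\<Union>i\<in>I. T i) \<subseteq> ou_ed_partitions n"
      using map_Suc_ou_ed by (fastforce simp: T_def sep_lists_def split: if_splits)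
  qed
  finally show ?thesis .
qed

section \<open>Comparing the coefficient sums\<close>

text \<open>The exponent \<open>k (2L - k)\<close> is at least \<open>4L - k\<close> and of the same parity, except that \<open>k = 2\<close>
  needs the exponent \<open>4L - 4\<close> itself; so 2 and 4 swap places.\<close>

lemma coef_block_le:
  assumes "4 \<le> L"
  shows "(\<Sum>k\<in>{2..L}. coef L (k * (2 * L - k)) n) \<le> (\<Sum>r\<in>{L..2 * L - 2}. coef L (r + 2 * L) n)"
proof -
  define h where "h = (\<lambda>k. if k = 2 then 2 * L - 4 else if k = 4 then 2 * L - 2 else 2 * L - k)"
  have inj: "inj_on h {2..L}" using assms by (auto simp: h_def inj_on_def)
  \<comment> \<open>The value 2L - 4 at k = 2 is at least L only because L \<ge> 4.\<close>
  have sub: "h ` {2..L} \<subseteq> {L..2 * L - 2}" using assms by (auto simp: h_def)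
  have le: "coef L (k * (2 * L - k)) n \<le> coef L (h k + 2 * L) n" if k: "k \<in> {2..L}" for k
  proof (rule coef_antimono)
    obtain d where d: "L = k + d" using k le_Suc_ex by auto
    have "h k + 2 * L \<le> k * (2 * L - k) \<and> (even (h k + 2 * L) \<longleftrightarrow> even (k * (2 * L - k)))"
    proof -
      consider "k = 2" | "k = 4" | "k = 3" | "5 \<le> k" using k by force
      then show ?thesis
      proof cases
        case 4
        then obtain j where j: "k = 5 + j" using le_Suc_ex by auto
        \<comment> \<open>The excess k(2L - k) - (4L - k) equals k(k - 3) + 2d(k - 2), which is even
          and nonnegative.\<close>
        show ?thesis unfolding d h_def j by (auto simp: algebra_simps)
      qed (use assms d in \<open>auto simp: h_def\<close>)
    qed
    then show "h k + 2 * L \<le> k * (2 * L - k)" "even (k * (2 * L - k) - (h k + 2 * L))"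
      by auto
  qed (use assms in auto)
  have "(\<Sum>k\<in>{2..L}. coef L (k * (2 * L - k)) n) \<le> (\<Sum>k\<in>{2..L}. coef L (h k + 2 * L) n)"
    by (rule sum_mono) (rule le)
  also have "\<dots> = (\<Sum>r\<in>h ` {2..L}. coef L (r + 2 * L) n)"
    using inj by (simp add: sum.reindex)
  also have "\<dots> \<le> (\<Sum>r\<in>{L..2 * L - 2}. coef L (r + 2 * L) n)"
    using sub by (intro sum_mono2) auto
  finally show ?thesis .
qed

lemma sum_blocks_le:
  "(\<Sum>L\<in>{2..n}. \<Sum>k\<in>{2..L}. coef L (k * (2 * L - k)) n)
   \<le> (\<Sum>L\<in>{2..n}. \<Sum>r\<in>{L..2 * L - 2}. coef L (r + 2 * L) n) + coef 1 2 n + coef 3 8 n"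
  (is "sum ?f _ \<le> sum ?g _ + _ + _")
proof (cases "3 \<le> n")
  case True
  then have split: "{2..n} = insert 2 (insert 3 {4..n})" by auto
  \<comment> \<open>Exponent 4 faces exponent 6, the wrong way round for
    \<open>coef_antimono\<close>. Splitting off \<open>coef 1 4 n\<close> raises the exponent of the
    rest to 8.\<close>
  have "?f 2 \<le> ?g 2 + coef 1 2 n"
  proof -
    have "coef 2 4 n = coef 1 4 n + coef 2 8 n"
      using coef_Suc[of 1 4 n] by (simp add: numeral_2_eq_2)
    moreover have "coef 1 4 n \<le> coef 1 2 n" "coef 2 8 n \<le> coef 2 6 n"
      by (auto intro!: coef_antimono)
    ultimately show ?thesis by simp
  qed
  \<comment> \<open>Exponents 8 and 9 face 9 and 10: the 9s cancel and \<open>coef 3 8 n\<close>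
    pays for the 8.\<close>
  moreover have "?f 3 \<le> ?g 3 + coef 3 8 n"
  proof -
    have "{2..3} = {2, 3::nat}" "{3..4} = {3, 4::nat}" by auto
    then show ?thesis by simp
  qed
  moreover have "sum ?f {4..n} \<le> sum ?g {4..n}"
    by (intro sum_mono coef_block_le) simp
  ultimately show ?thesis unfolding split by simp
next
  case False
  then consider "n < 2" | "n = 2" by linarith
  then show ?thesis by cases (auto simp: coef_def)
qed

text \<open>Apply \<open>coef_expand\<close> to each \<open>coef r r n\<close> with s = (r + 1) div
  2. The leading terms with r = 2s and r = 2s - 1 give the first two sums; the bound 2n lets s run
  up to n.\<close>

lemma sum_coef_diag:
  "(\<Sum>r\<le>n. coef r (2 * r) n) + (\<Sum>r\<in>{1..n}. coef r (2 * r - 1) n) +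
   (\<Sum>L\<in>{2..n}. \<Sum>r\<in>{L..2 * L - 2}. coef L (r + 2 * L) n) \<le> (\<Sum>r\<le>2 * n. coef r r n)"
proof -
  have split: "{..2 * n} = (\<lambda>r. 2 * r) ` {..n} \<union> (\<lambda>r. 2 * r - 1) ` {1..n}"
  proof -
    have "r \<in> (\<lambda>r. 2 * r) ` {..n} \<union> (\<lambda>r. 2 * r - 1) ` {1..n}" if "r \<le> 2 * n" for r
    proof (cases "even r")
      case True
      then show ?thesis using that by (auto elim!: evenE)
    next
      case False
      then obtain j where "r = 2 * j + 1" by (elim oddE)
      then have "r = 2 * Suc j - 1" "Suc j \<in> {1..n}" using that by auto
      then show ?thesis by blast
    qed
    then show ?thesis by auto
  qed
  have "(\<Sum>r\<le>2 * n. coef ((r + 1) div 2) r n) =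
      (\<Sum>r\<in>(\<lambda>r. 2 * r) ` {..n}. coef ((r + 1) div 2) r n) +
      (\<Sum>r\<in>(\<lambda>r. 2 * r - 1) ` {1..n}. coef ((r + 1) div 2) r n)"
    unfolding split
  proof (rule sum.union_disjoint)
    have "2 * a \<noteq> 2 * b - 1" if "1 \<le> b" for a b :: nat using that by presburger
    then show "(\<lambda>r. 2 * r) ` {..n} \<inter> (\<lambda>r. 2 * r - 1) ` {1..n} = {}" by fastforce
  qed auto
  also have "(\<Sum>r\<in>(\<lambda>r. 2 * r) ` {..n}. coef ((r + 1) div 2) r n) = (\<Sum>r\<le>n. coef r (2 * r) n)"
    by (subst sum.reindex) (auto simp: inj_on_def)
  also have "(\<Sum>r\<in>(\<lambda>r. 2 * r - 1) ` {1..n}. coef ((r + 1) div 2) r n) = (\<Sum>r\<in>{1..n}. coef r (2 * r - 1) n)"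
    by (subst sum.reindex) (auto simp: inj_on_def intro!: sum.cong)
  finally have 1: "(\<Sum>r\<le>2 * n. coef ((r + 1) div 2) r n) =
    (\<Sum>r\<le>n. coef r (2 * r) n) + (\<Sum>r\<in>{1..n}. coef r (2 * r - 1) n)" .
  have "(\<Sum>L\<in>{2..n}. \<Sum>r\<in>{L..2 * L - 2}. coef L (r + 2 * L) n) =
      (\<Sum>(L, r)\<in>(SIGMA L:{2..n}. {L..2 * L - 2}). coef L (r + 2 * L) n)"
    by (simp add: sum.Sigma)
  also have "\<dots> = (\<Sum>(r, L)\<in>prod.swap ` (SIGMA L:{2..n}. {L..2 * L - 2}). coef L (r + 2 * L) n)"
    by (subst sum.reindex) (auto simp: inj_on_def intro!: sum.cong)
  also have "\<dots> \<le> (\<Sum>(r, L)\<in>(SIGMA r:{..2 * n}. {(r + 1) div 2<..r}). coef L (r + 2 * L) n)"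
    \<comment> \<open>The condition r \<le> 2L - 2 is equivalent to (r + 1) div 2 < L.\<close>
    by (rule sum_mono2) auto
  also have "\<dots> = (\<Sum>r\<le>2 * n. \<Sum>L\<in>{(r + 1) div 2<..r}. coef L (r + 2 * L) n)"
    by (simp add: sum.Sigma)
  finally have 2: "(\<Sum>L\<in>{2..n}. \<Sum>r\<in>{L..2 * L - 2}. coef L (r + 2 * L) n)
    \<le> (\<Sum>r\<le>2 * n. \<Sum>L\<in>{(r + 1) div 2<..r}. coef L (r + 2 * L) n)" .
  have "(\<Sum>r\<le>2 * n. coef r r n) = (\<Sum>r\<le>2 * n. coef ((r + 1) div 2) r n +
      (\<Sum>L\<in>{(r + 1) div 2<..r}. coef L (r + 2 * L) n))"
    by (intro sum.cong refl coef_expand) auto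
  then show ?thesis using 1 2 by (simp add: sum.distrib)
qed

lemma p_eu_od_add_le: "p_eu_od n + coef 2 5 n + coef 2 6 n \<le> p_ou_ed n"
proof -
  have "(\<Sum>r\<le>n. \<Sum>k\<in>{1..r}. coef r (k * (2 * r - k)) n) =
      (\<Sum>r\<in>{1..n}. coef r (2 * r - 1) n) +
      (\<Sum>L\<in>{2..n}. \<Sum>k\<in>{2..L}. coef L (k * (2 * L - k)) n)"
  proof -
    have "(\<Sum>r\<le>n. \<Sum>k\<in>{1..r}. coef r (k * (2 * r - k)) n) =
        (\<Sum>r\<in>{1..n}. \<Sum>k\<in>{1..r}. coef r (k * (2 * r - k)) n)"
      by (rule sum.mono_neutral_right) auto
    also have "\<dots> = (\<Sum>r\<in>{1..n}. coef r (2 * r - 1) n + (\<Sum>k\<in>{2..r}. coef r (k * (2 * r - k)) n))"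
    proof (rule sum.cong[OF refl])
      fix r assume "r \<in> {1..n}"
      then have "{1..r} = insert 1 {2..r}" by auto
      then show "(\<Sum>k\<in>{1..r}. coef r (k * (2 * r - k)) n) =
          coef r (2 * r - 1) n + (\<Sum>k\<in>{2..r}. coef r (k * (2 * r - k)) n)" by simp
    qed
    also have "\<dots> = (\<Sum>r\<in>{1..n}. coef r (2 * r - 1) n) +
        (\<Sum>r\<in>{1..n}. \<Sum>k\<in>{2..r}. coef r (k * (2 * r - k)) n)"
      by (rule sum.distrib)
    also have "(\<Sum>r\<in>{1..n}. \<Sum>k\<in>{2..r}. coef r (k * (2 * r - k)) n) =
        (\<Sum>L\<in>{2..n}. \<Sum>k\<in>{2..L}. coef L (k * (2 * L - k)) n)"
      by (rule sum.mono_neutral_right) auto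
    finally show ?thesis .
  qed
  then have "p_eu_od n \<le> (\<Sum>r\<le>n. coef r (2 * r) n) + (\<Sum>r\<in>{1..n}. coef r (2 * r - 1) n) +
      (\<Sum>L\<in>{2..n}. \<Sum>k\<in>{2..L}. coef L (k * (2 * L - k)) n)"
    using p_eu_od_le[of n] by (simp add: sum.distrib)
  moreover have "(\<Sum>r\<le>2 * n. coef r r n) + coef 1 2 n + coef 2 6 n + coef 3 8 n + coef 2 5 n \<le> p_ou_ed n"
  proof -
    define I where "I = (\<lambda>r. (r, 0::nat)) ` {..2 * n}"
    \<comment> \<open>The exponents are 2, 6, 8, 5 in this order; 2 and 8 are consumed by
      \<open>sum_blocks_le\<close>, while 5 and 6 remain.\<close>
    define J where "J = {(1::nat, 1::nat), (2, 2), (3, 1), (2, 1)}"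
    define c where "c = (\<lambda>(r, k). coef r (k * (2 * r - k) + r) n)"
    have "sum c (I \<union> J) = sum c I + sum c J"
      by (rule sum.union_disjoint) (auto simp: I_def J_def)
    moreover have "sum c I = (\<Sum>r\<le>2 * n. coef r r n)"
      unfolding I_def by (subst sum.reindex) (auto simp: inj_on_def c_def)
    moreover have "sum c J = coef 1 2 n + coef 2 6 n + coef 3 8 n + coef 2 5 n"
      by (simp add: J_def c_def eval_nat_numeral)
    moreover have "sum c (I \<union> J) \<le> p_ou_ed n"
      unfolding c_def by (rule p_ou_ed_ge) (auto simp: I_def J_def)
    ultimately show ?thesis by linarith
  qed
  ultimately show ?thesis using sum_blocks_le[of n] sum_coef_diag[of n] by linarith
qed

theorem theorem3p4:
  shows "(\<forall>n::nat. p_eu_od n \<le> p_ou_ed n) \<and> (\<forall>n::nat. n \<ge> 5 \<longrightarrow> p_eu_od n < p_ou_ed n)"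
proof (intro conjI allI impI)
  fix n :: nat
  show "p_eu_od n \<le> p_ou_ed n" using p_eu_od_add_le[of n] by linarith
next
  fix n :: nat
  assume n: "5 \<le> n"
  \<comment> \<open>Exponent 5 serves the odd n, exponent 6 the even ones.\<close>
  have "0 < coef 2 5 n + coef 2 6 n"
  proof (cases "odd n")
    case True
    then show ?thesis using n coef_pos[of 2 5 n] by simp
  next
    case False
    then have "6 \<le> n" using n by (cases "n = 5") auto
    then show ?thesis using False coef_pos[of 2 6 n] by simp
  qed
  then show "p_eu_od n < p_ou_ed n" using p_eu_od_add_le[of n] by linarith
qed

end
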